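(* Let $f:\bigcup_{i=1}^{\infty}\mathbb{Z}_{+}^{i}\to\mathbb{R}$ satisfy $f(x_1,x_2,\dots,x_i)=f(x_i,x_{i-1},\dots,x_1)$ for $i=1,2,\dots$, and suppose that (a) $\dfrac{f(x)-f(y)}{x-y}\neq f(2)-f(1)$ for all $x\neq y$ with $x,y\ge 3$; (b) $g_t(x)\neq g_t(2)$ for all $x\neq 2$ and $t=0,1,\dots$, where $g_t(x)=f(x,\underbrace{2,\dots,2}_{t},1)-f(x,\underbrace{2,\dots,2}_{t+1})$. Then the corresponding higher-order invariants ${}^{h}I_f$ distinguish the graphs in the set $\mathcal{G}_n$ of all starlike trees with $n$ vertices; i.e., for $S_n,S'_n\in\mathcal{G}_n$, one has $S_n\cong S'_n$ if and only if ${}^{h}I_f(S_n)={}^{h}I_f(S'_n)$ for all $h\ge 0$.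
   Context: $\mathbb{Z}_+$ denotes the positive integers; $x,y$ range over $\mathbb{Z}_+$. For a simple connected graph $G$, a path of length $h\ge 0$ is a sequence $v_0v_1\cdots v_h$ of distinct vertices with $v_{i-1}$ adjacent to $v_i$ for $i=1,\dots,h$; a path and its reverse $v_hv_{h-1}\cdots v_0$ are counted as one path. The $h$-order invariant is ${}^{h}I_f(G)=\sum_{v_0v_1\cdots v_h} f(d_0,d_1,\dots,d_h)$, where the sum runs over all paths of length $h$ in $G$ and $d_i$ is the degree of $v_i$ in $G$ (so ${}^{0}I_f(G)=\sum_{v\in V(G)}f(d(v))$). A starlike tree is a tree with exactly one vertex of degree greater than $2$ (its root, or center). *)

theory Defs
  imports Complex_Main "Graph_Theory.Graph_Theory"
begin

text \<open>
  Finite simple graphs are the library's locale \<open>graph\<close>: finite, loop-free, symmetric digraphs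
  without parallel arcs. An undirected edge is a pair of opposite arcs, so the degree of a vertex
  is its \<open>out_degree\<close>.
\<close>

text \<open>
  The library's \<open>tree\<close> cannot be used here: its \<open>forest\<close> excludes directed cycles, and in a
  symmetric digraph every edge \<open>uv\<close> gives the directed cycle \<open>u, v, u\<close>. An undirected cycle has
  at least three distinct vertices.
\<close>

definition undirected_cycle :: "('a, 'b) pre_digraph \<Rightarrow> 'a list \<Rightarrow> bool" where
  "undirected_cycle G p \<longleftrightarrow> vpath p G \<and> 3 \<le> length p \<and> (last p, hd p) \<in> arcs_ends G"

definition undirected_tree :: "('a, 'b) pre_digraph \<Rightarrow> bool" where
  "undirected_tree G \<longleftrightarrow> graph G \<and> connected G \<and> \<not> (\<exists>p. undirected_cycle G p)"

definition starlike_tree :: "('a, 'b) pre_digraph \<Rightarrow> bool" where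
  "starlike_tree G \<longleftrightarrow> undirected_tree G \<and> (\<exists>!v. v \<in> verts G \<and> out_degree G v > 2)"

definition starlike_trees :: "nat \<Rightarrow> ('a, 'b) pre_digraph set" where
  "starlike_trees n = {G. starlike_tree G \<and> card (verts G) = n}"

text \<open>A path and its reverse are one path: the class \<open>{p, rev p}\<close>.\<close>

definition undirected_paths :: "('a, 'b) pre_digraph \<Rightarrow> nat \<Rightarrow> 'a list set set" where
  "undirected_paths G h = (\<lambda>p. {p, rev p}) ` {p. vpath p G \<and> vwalk_length p = h}"

text \<open>
  A function on nonempty tuples of positive integers is given by its values on lists. The
  representative chosen by \<open>SOME\<close> is irrelevant when \<open>f\<close> is invariant under reversal, see
  \<open>summand_independent_of_orientation\<close> below.
\<close>

definition order_invariant :: "(nat list \<Rightarrow> real) \<Rightarrow> nat \<Rightarrow> ('a, 'b) pre_digraph \<Rightarrow> real" where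
  "order_invariant f h G =
     (\<Sum>c\<in>undirected_paths G h. f (map (out_degree G) (SOME p. p \<in> c)))"

definition g_diff :: "(nat list \<Rightarrow> real) \<Rightarrow> nat \<Rightarrow> nat \<Rightarrow> real" where
  "g_diff f t x = f (x # replicate t 2 @ [1]) - f (x # replicate (t + 1) 2)"

lemma summand_independent_of_orientation:
  assumes "f (rev (map (out_degree G) p)) = f (map (out_degree G) p)"
  shows "f (map (out_degree G) (SOME q. q \<in> {p, rev p})) = f (map (out_degree G) p)"
proof -
  have "(SOME q. q \<in> {p, rev p}) \<in> {p, rev p}"
    by (rule someI[of _ p]) simp
  then show ?thesis
    using assms by (auto simp: rev_map)
qed

lemma order_invariant_0:
  "order_invariant f 0 G = (\<Sum>v\<in>verts G. f [out_degree G v])"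
proof -
  have "{p. vpath p G \<and> vwalk_length p = 0} = (\<lambda>v. [v]) ` verts G"
  proof (intro set_eqI iffI)
    fix p assume "p \<in> {p. vpath p G \<and> vwalk_length p = 0}"
    then show "p \<in> (\<lambda>v. [v]) ` verts G"
      by (cases p) (auto simp: vpath_def vwalk_def)
  qed (auto simp: vpath_def vwalk_def)
  then have "undirected_paths G 0 = (\<lambda>v. {[v]}) ` verts G"
    unfolding undirected_paths_def by (simp add: image_image)
  then show ?thesis
    unfolding order_invariant_def by (subst sum.reindex_cong[of "\<lambda>v. {[v]}"]) (auto simp: inj_on_def)
qed

end

theory Submission
  imports Defs "HOL-Library.Multiset"
begin

text \<open>
  A starlike tree is a spider: disjoint paths, its legs, attached to a root of degree \<open>k \<ge> 3\<close>. Up to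
  isomorphism it is given by the multiset of the leg lengths, so it has to be shown that the
  invariants and the number \<open>n\<close> of vertices determine how many legs of each length there are.

  The invariant of order \<open>0\<close> is \<open>f(k) + k f(1) + (n - 1 - k) f(2)\<close>. Two different values of \<open>k\<close>
  with the same result would contradict (a); hence \<open>k\<close> is determined.

  Let \<open>h \<ge> 1\<close> and suppose that the numbers of legs of length less than \<open>h\<close> are known. A path of
  length \<open>h\<close> either has the root as an inner vertex or lies on one leg together with the root. A
  path of the first kind stays at distance less than \<open>h\<close> from the root, so the total
  contribution of these paths is known (\<open>cross_sum_truncate\<close>). On a leg of length
  \<open>l > h\<close> the paths of the second kind contribute an affine function of \<open>l\<close>, and the sum of
  an affine function over all legs depends on \<open>k\<close> and \<open>n\<close> only. After this function has been subtracted
  from the contribution of every leg, long legs contribute \<open>0\<close>, legs shorter than \<open>h\<close> contribute a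
  known amount, and each leg of length \<open>h\<close> contributes \<open>g(k) - g(2)\<close> with \<open>g\<close> the function of (b)
  for \<open>t = h - 1\<close> (\<open>leg_excess_exact\<close>). This is not \<open>0\<close>, so the number of legs of length \<open>h\<close> can be read off
  (\<open>spider_leg_lengths_determined\<close>).

  To make this precise, every starlike tree is shown to be isomorphic to a concrete
  spider with a sorted list of leg lengths (\<open>starlike_tree_adj_iso_spider\<close>), whose paths are
  enumerated explicitly (\<open>spider_vpath_cases\<close>, \<open>path_sum_spider\<close>). Two starlike trees with the same
  invariants are then isomorphic to the same spider. The converse is the invariance of path sums
  under isomorphism (\<open>path_sum_adj_iso\<close>).
\<close>

section \<open>Paths and degrees in simple graphs\<close>
lemma vpath_iff_nth:
  "vpath p G \<longleftrightarrow> p \<noteq> [] \<and> distinct p \<and> set p \<subseteq> verts G \<and>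
     (\<forall>i. Suc i < length p \<longrightarrow> (p ! i, p ! Suc i) \<in> arcs_ends G)"
proof -
  have "set (vwalk_arcs p) \<subseteq> arcs_ends G \<longleftrightarrow>
      (\<forall>i. Suc i < length p \<longrightarrow> (p ! i, p ! Suc i) \<in> arcs_ends G)"
    by (induction p rule: vwalk_arcs.induct) (auto simp: nth_Cons' less_Suc_eq_0_disj)
  then show ?thesis
    by (auto simp: vpath_def vwalk_def)
qed

lemma vpath_rev:
  assumes "graph G" "vpath p G"
  shows "vpath (rev p) G"
proof -
  interpret graph G by fact
  have "sym (arcs_ends G)"
    using sym_arcs by (simp add: symmetric_def)
  moreover have "(rev p ! i, rev p ! Suc i) \<in> arcs_ends G" if "Suc i < length p" for i
  proof -
    define j where "j = length p - Suc (Suc i)"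
    have "(p ! j, p ! Suc j) \<in> arcs_ends G"
      using assms(2) that by (simp add: vpath_iff_nth j_def)
    moreover have "rev p ! Suc i = p ! j" "rev p ! i = p ! Suc j"
      using that by (auto simp: rev_nth j_def Suc_diff_Suc)
    ultimately show ?thesis
      using \<open>sym (arcs_ends G)\<close> by (simp add: symD)
  qed
  ultimately show ?thesis
    using assms(2) by (simp add: vpath_iff_nth)
qed

lemma vpath_snoc_iff:
  assumes "p \<noteq> []"
  shows "vpath (p @ [x]) G \<longleftrightarrow>
    vpath p G \<and> x \<notin> set p \<and> x \<in> verts G \<and> (last p, x) \<in> arcs_ends G"
proof -
  have "vwalk (p @ [x]) G \<longleftrightarrow> vwalk p G \<and> x \<in> verts G \<and> (last p, x) \<in> arcs_ends G"
    using assms by (auto simp: vwalk_def set_vwalk_arcs_snoc)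
  then show ?thesis
    by (auto simp: vpath_def)
qed

lemma vpath_drop:
  assumes "vpath p G" "m < length p"
  shows "vpath (drop m p) G"
  using assms set_drop_subset[of m p] by (auto simp: vpath_iff_nth)

lemma finite_vpaths:
  assumes "graph G"
  shows "finite {p. vpath p G}"
proof -
  interpret graph G by fact
  have "{p. vpath p G} \<subseteq> {p. set p \<subseteq> verts G \<and> distinct p}"
    by (auto simp: vpath_iff_nth)
  then show ?thesis
    using finite_subset_distinct[OF finite_verts] finite_subset by blast
qed

lemma arcs_ends_in_verts:
  "graph G \<Longrightarrow> (u, v) \<in> arcs_ends G \<Longrightarrow> u \<in> verts G \<and> v \<in> verts G"
  using wf_digraph.adj_in_verts[of G] by (auto simp: graph_def digraph_def fin_digraph_def)

lemma arcs_ends_sym: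
  "graph G \<Longrightarrow> (u, v) \<in> arcs_ends G \<Longrightarrow> (v, u) \<in> arcs_ends G"
  by (rule arcs_ends_symmetric[OF sym_digraph.sym_arcs])
    (simp_all add: graph_def pseudo_graph_def)

lemma arcs_ends_irrefl: "graph G \<Longrightarrow> (v, v) \<notin> arcs_ends G"
  using loopfree_digraph.adj_not_same[of G] by (auto simp: graph_def digraph_def)

text \<open>
  Without parallel arcs the degree depends on the adjacency relation only. From here on the arcs
  themselves can be forgotten: paths, degrees and isomorphism are all expressed by the vertices and
  \<^const>\<open>arcs_ends\<close>.
\<close>
lemma out_degree_eq_card_neighbours:
  assumes "graph G"
  shows "out_degree G v = card {w. (v, w) \<in> arcs_ends G}"
proof -
  interpret graph G by fact
  have "inj_on (head G) (out_arcs G v)"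
    by (rule inj_onI) (auto intro!: no_multi_arcs simp: arc_to_ends_def)
  moreover have "head G ` out_arcs G v = {w. (v, w) \<in> arcs_ends G}"
    by (auto simp: arcs_ends_conv)
  ultimately show ?thesis
    unfolding out_degree_def by (metis card_image)
qed

section \<open>Path sums and isomorphism\<close>
text \<open>
  The sum over oriented paths replaces classes \<open>{p, rev p}\<close> with chosen representatives by plain
  lists, which are easy to transport along isomorphisms and to enumerate. Every class of positive
  length is counted twice.
\<close>
definition path_sum :: "(nat list \<Rightarrow> real) \<Rightarrow> nat \<Rightarrow> ('a, 'b) pre_digraph \<Rightarrow> real" where
  "path_sum f h G = (\<Sum>p | vpath p G \<and> vwalk_length p = h. f (map (out_degree G) p))"

lemma path_sum_eq_order_invariant:
  assumes G: "graph G"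
    and sym: "\<And>p. vpath p G \<Longrightarrow> f (rev (map (out_degree G) p)) = f (map (out_degree G) p)"
  shows "path_sum f h G = (if h = 0 then 1 else 2) * order_invariant f h G"
proof -
  let ?P = "{p. vpath p G \<and> vwalk_length p = h}"
  let ?s = "\<lambda>c. f (map (out_degree G) (SOME p. p \<in> c))"
  have fin: "finite ?P"
    using finite_vpaths[OF G] by (rule rev_finite_subset) auto
  have fibre: "(\<Sum>p | p \<in> ?P \<and> {p, rev p} = c. f (map (out_degree G) p))
      = (if h = 0 then 1 else 2) * ?s c" if c: "c \<in> undirected_paths G h" for c
  proof -
    obtain q where q: "q \<in> ?P" "c = {q, rev q}"
      using c by (auto simp: undirected_paths_def)
    then have len: "length q = Suc h" and "distinct q"
      by (cases q; simp add: vpath_iff_nth)+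
    \<comment> \<open>The fibre over a class has two elements unless its path is a palindrome; a path with
      distinct vertices is one only if it has a single vertex.\<close>
    have "{p. p \<in> ?P \<and> {p, rev p} = c} = {q, rev q}"
      using q vpath_rev[OF G] by (auto simp: doubleton_eq_iff)
    moreover have "q = rev q \<longleftrightarrow> h = 0"
    proof
      assume "q = rev q"
      moreover have "rev q ! 0 = q ! h"
        using len by (simp add: rev_nth)
      ultimately have "q ! 0 = q ! h"
        by metis
      then show "h = 0"
        using \<open>distinct q\<close> len by (simp add: nth_eq_iff_index_eq)
    next
      assume "h = 0"
      then show "q = rev q"
        using len by (auto simp: length_Suc_conv)
    qed
    moreover have "f (map (out_degree G) (rev q)) = f (map (out_degree G) q)"
      using sym q by (simp add: rev_map)
    moreover have "?s c = f (map (out_degree G) q)"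
      unfolding q(2) by (rule summand_independent_of_orientation) (use sym q in auto)
    ultimately show ?thesis
      by (cases "q = rev q") auto
  qed
  have "path_sum f h G = (\<Sum>c\<in>undirected_paths G h.
      (\<Sum>p | p \<in> ?P \<and> {p, rev p} = c. f (map (out_degree G) p)))"
    unfolding path_sum_def
    by (rule sum.group[symmetric]) (use fin in \<open>auto simp: undirected_paths_def\<close>)
  then show ?thesis
    using fibre by (simp add: order_invariant_def sum_distrib_left)
qed

definition adj_iso :: "('a \<Rightarrow> 'c) \<Rightarrow> ('a, 'b) pre_digraph \<Rightarrow> ('c, 'd) pre_digraph \<Rightarrow> bool" where
  "adj_iso \<phi> G H \<longleftrightarrow> bij_betw \<phi> (verts G) (verts H) \<and>
     (\<forall>u\<in>verts G. \<forall>v\<in>verts G. (u, v) \<in> arcs_ends G \<longleftrightarrow> (\<phi> u, \<phi> v) \<in> arcs_ends H)"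

lemma adj_iso_inv:
  assumes "adj_iso \<phi> G H"
  shows "adj_iso (the_inv_into (verts G) \<phi>) H G"
proof -
  have bij: "bij_betw \<phi> (verts G) (verts H)"
    using assms by (simp add: adj_iso_def)
  let ?\<psi> = "the_inv_into (verts G) \<phi>"
  have inv: "?\<psi> v \<in> verts G" "\<phi> (?\<psi> v) = v" if "v \<in> verts H" for v
    using bij_betwE[OF bij_betw_the_inv_into[OF bij]] f_the_inv_into_f_bij_betw[OF bij] that
    by auto
  then show ?thesis
    using assms bij_betw_the_inv_into[OF bij] by (simp add: adj_iso_def)
qed

lemma adj_iso_comp:
  assumes "adj_iso \<phi> G H" "adj_iso \<psi> H K"
  shows "adj_iso (\<psi> \<circ> \<phi>) G K"
  using assms unfolding adj_iso_def by (auto intro: bij_betw_trans dest: bij_betwE)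

text \<open>
  In a simple graph an arc is determined by its ends, so a bijection of the vertices that respects
  adjacency carries the arcs along in exactly one way.
\<close>
lemma digraph_iso_iff_adj_iso:
  assumes G: "graph G" and H: "graph H"
  shows "digraph_iso G H \<longleftrightarrow> (\<exists>\<phi>. adj_iso \<phi> G H)"
proof
  assume "digraph_iso G H"
  then obtain k where k: "pre_digraph.digraph_isomorphism G k" and Hk: "H = app_iso k G"
    by (auto simp: digraph_iso_def)
  interpret graph G by fact
  have inj: "inj_on (iso_verts k) (verts G)"
    using k by (simp add: digraph_isomorphism_def)
  have "arcs_ends H = (\<lambda>(u, v). (iso_verts k u, iso_verts k v)) ` arcs_ends G"
    using k unfolding Hk by (auto simp: arcs_ends_conv image_image iso_verts_tail iso_verts_head)
  then have "(u, v) \<in> arcs_ends G \<longleftrightarrow> (iso_verts k u, iso_verts k v) \<in> arcs_ends H"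
    if "u \<in> verts G" "v \<in> verts G" for u v
    using that adj_in_verts by (auto simp: inj_on_eq_iff[OF inj])
  then have "adj_iso (iso_verts k) G H"
    using inj by (simp add: adj_iso_def bij_betw_def Hk)
  then show "\<exists>\<phi>. adj_iso \<phi> G H"
    by blast
next
  assume "\<exists>\<phi>. adj_iso \<phi> G H"
  then obtain \<phi> where bij: "bij_betw \<phi> (verts G) (verts H)"
    and adj: "\<And>u v. u \<in> verts G \<Longrightarrow> v \<in> verts G \<Longrightarrow>
      (u, v) \<in> arcs_ends G \<longleftrightarrow> (\<phi> u, \<phi> v) \<in> arcs_ends H"
    unfolding adj_iso_def by blast
  interpret G: graph G by fact
  interpret H: graph H by fact
  define \<alpha> where "\<alpha> e = the_inv_into (arcs H) (arc_to_ends H) (\<phi> (tail G e), \<phi> (head G e))" for e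
  have ends: "\<alpha> e \<in> arcs H \<and> tail H (\<alpha> e) = \<phi> (tail G e) \<and> head H (\<alpha> e) = \<phi> (head G e)"
    if e: "e \<in> arcs G" for e
  proof -
    have "(\<phi> (tail G e), \<phi> (head G e)) \<in> arcs_ends H"
      using adj[of "tail G e" "head G e"] e by (auto simp: arcs_ends_conv)
    then have im: "(\<phi> (tail G e), \<phi> (head G e)) \<in> arc_to_ends H ` arcs H"
      by (simp add: arcs_ends_def)
    then show ?thesis
      using the_inv_into_into[OF H.inj_on_arc_to_ends im order.refl]
        f_the_inv_into_f[OF H.inj_on_arc_to_ends im]
      by (simp add: \<alpha>_def arc_to_ends_def)
  qed
  let ?k = "\<lparr>iso_verts = \<phi>, iso_arcs = \<alpha>, iso_head = head H, iso_tail = tail H\<rparr>"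
  have "inj_on \<alpha> (arcs G)"
  proof (rule inj_onI)
    fix d e assume de: "d \<in> arcs G" "e \<in> arcs G" "\<alpha> d = \<alpha> e"
    then have "\<phi> (tail G d) = \<phi> (tail G e)" "\<phi> (head G d) = \<phi> (head G e)"
      using ends by metis+
    then have "arc_to_ends G d = arc_to_ends G e"
      using inj_on_eq_iff[OF bij_betw_imp_inj_on[OF bij]] de by (simp add: arc_to_ends_def)
    then show "d = e"
      using de G.no_multi_arcs by blast
  qed
  moreover have "\<alpha> ` arcs G = arcs H"
  proof
    show "\<alpha> ` arcs G \<subseteq> arcs H"
      using ends by auto
    show "arcs H \<subseteq> \<alpha> ` arcs G"
    proof
      fix e assume e: "e \<in> arcs H"
      then have "tail H e \<in> \<phi> ` verts G" "head H e \<in> \<phi> ` verts G"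
        using bij_betw_imp_surj_on[OF bij] by simp_all
      then obtain u v where uv: "u \<in> verts G" "v \<in> verts G" "tail H e = \<phi> u" "head H e = \<phi> v"
        by blast
      moreover have "(\<phi> u, \<phi> v) \<in> arcs_ends H"
        using e uv(3,4) by (auto simp: arcs_ends_conv intro!: rev_image_eqI)
      ultimately have "(u, v) \<in> arcs_ends G"
        using adj by simp
      then obtain d where d: "d \<in> arcs G" "tail G d = u" "head G d = v"
        by auto
      then have "arc_to_ends H (\<alpha> d) = arc_to_ends H e"
        using ends uv by (simp add: arc_to_ends_def)
      then show "e \<in> \<alpha> ` arcs G"
        using H.no_multi_arcs d e ends by blast
    qed
  qed
  ultimately have "G.digraph_isomorphism ?k" "H = app_iso ?k G"
    using bij ends G.wf_digraph by (auto simp: G.digraph_isomorphism_def app_iso_def bij_betw_def)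
  then show "digraph_iso G H"
    unfolding digraph_iso_def by blast
qed

lemma adj_iso_out_degree:
  assumes G: "graph G" and H: "graph H" and iso: "adj_iso \<phi> G H" and v: "v \<in> verts G"
  shows "out_degree H (\<phi> v) = out_degree G v"
proof -
  have inj: "inj_on \<phi> (verts G)" and im: "\<phi> ` verts G = verts H"
    using iso by (auto simp: adj_iso_def bij_betw_def)
  have adj: "(v, w) \<in> arcs_ends G \<longleftrightarrow> (\<phi> v, \<phi> w) \<in> arcs_ends H" if "w \<in> verts G" for w
    using iso v that by (simp add: adj_iso_def)
  have "{w. (\<phi> v, w) \<in> arcs_ends H} = \<phi> ` {w. (v, w) \<in> arcs_ends G}"
  proof (intro equalityI subsetI)
    fix w assume w: "w \<in> {w. (\<phi> v, w) \<in> arcs_ends H}"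
    then obtain w' where "w' \<in> verts G" "w = \<phi> w'"
      using im arcs_ends_in_verts[OF H] by blast
    then show "w \<in> \<phi> ` {w. (v, w) \<in> arcs_ends G}"
      using adj w by blast
  qed (use adj arcs_ends_in_verts[OF G] in auto)
  moreover have "inj_on \<phi> {w. (v, w) \<in> arcs_ends G}"
    using inj by (rule inj_on_subset) (use arcs_ends_in_verts[OF G] in auto)
  ultimately show ?thesis
    by (simp add: out_degree_eq_card_neighbours G H card_image)
qed

lemma adj_iso_vpath:
  assumes iso: "adj_iso \<phi> G H" and p: "set p \<subseteq> verts G"
  shows "vpath (map \<phi> p) H \<longleftrightarrow> vpath p G"
proof -
  have inj: "inj_on \<phi> (set p)"
    using iso p by (auto simp: adj_iso_def bij_betw_def intro: inj_on_subset)
  have "\<phi> ` set p \<subseteq> verts H"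
    using iso p by (auto simp: adj_iso_def bij_betw_def)
  moreover have "(\<phi> (p ! i), \<phi> (p ! Suc i)) \<in> arcs_ends H \<longleftrightarrow> (p ! i, p ! Suc i) \<in> arcs_ends G"
    if "Suc i < length p" for i
  proof -
    have "p ! i \<in> verts G" "p ! Suc i \<in> verts G"
      using p that by (meson Suc_lessD nth_mem subsetD)+
    then show ?thesis
      using iso by (simp add: adj_iso_def)
  qed
  ultimately show ?thesis
    using p inj by (auto simp: vpath_iff_nth distinct_map)
qed

lemma path_sum_adj_iso:
  assumes G: "graph G" and H: "graph H" and iso: "adj_iso \<phi> G H"
  shows "path_sum f h H = path_sum f h G"
proof -
  have inj: "inj_on \<phi> (verts G)" and im: "\<phi> ` verts G = verts H"
    using iso by (auto simp: adj_iso_def bij_betw_def)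
  let ?P = "{p. vpath p G \<and> vwalk_length p = h}"
  have sub: "set p \<subseteq> verts G" if "vpath p G" for p
    using that by (simp add: vpath_iff_nth)
  have inj_map: "inj_on (map \<phi>) ?P"
    by (rule inj_on_mapI, rule inj_on_subset[OF inj]) (use sub in blast)
  have image: "{q. vpath q H \<and> vwalk_length q = h} = map \<phi> ` ?P"
  proof (intro equalityI subsetI)
    fix q assume q: "q \<in> {q. vpath q H \<and> vwalk_length q = h}"
    then have "q \<in> lists (\<phi> ` verts G)"
      using im by (auto simp: vpath_iff_nth)
    then obtain p where p: "q = map \<phi> p" "set p \<subseteq> verts G"
      by (auto simp: lists_image in_lists_conv_set)
    then have "p \<in> ?P"
      using q adj_iso_vpath[OF iso p(2)] by simp
    then show "q \<in> map \<phi> ` ?P"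
      using p by blast
  next
    fix q assume "q \<in> map \<phi> ` ?P"
    then obtain p where "q = map \<phi> p" "vpath p G" "vwalk_length p = h"
      by blast
    then show "q \<in> {q. vpath q H \<and> vwalk_length q = h}"
      using adj_iso_vpath[OF iso sub] by simp
  qed
  have degrees: "map (out_degree H) (map \<phi> p) = map (out_degree G) p" if "vpath p G" for p
    using sub[OF that] adj_iso_out_degree[OF G H iso] by auto
  have "path_sum f h H = (\<Sum>p\<in>?P. f (map (out_degree H) (map \<phi> p)))"
    unfolding path_sum_def image sum.reindex[OF inj_map] by (simp only: o_def)
  also have "\<dots> = path_sum f h G"
    unfolding path_sum_def by (rule sum.cong[OF refl]) (simp only: mem_Collect_eq degrees)
  finally show ?thesis .
qed

section \<open>Spiders\<close>
text \<open>
  The spider with legs of lengths \<open>ls\<close> lives on pairs: \<open>(i, j)\<close> is the vertex at distance \<open>j\<close> from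
  the root on leg \<open>i\<close>. All legs share their vertex at distance \<open>0\<close>, so the pairs \<open>(i, 0)\<close> have to be
  identified; \<open>(0, 0)\<close> stands for the root.
\<close>
definition spider_vert :: "nat \<Rightarrow> nat \<Rightarrow> nat \<times> nat" where
  "spider_vert i j = (if j = 0 then (0, 0) else (i, j))"

definition spider_edges :: "nat list \<Rightarrow> ((nat \<times> nat) \<times> (nat \<times> nat)) set" where
  "spider_edges ls =
     {(spider_vert i j, spider_vert i (Suc j)) | i j. i < length ls \<and> j < ls ! i}"

definition spider :: "nat list \<Rightarrow> (nat \<times> nat, (nat \<times> nat) \<times> (nat \<times> nat)) pre_digraph" where
  "spider ls = \<lparr>verts = {spider_vert i j | i j. i < length ls \<and> j \<le> ls ! i},
     arcs = spider_edges ls \<union> (spider_edges ls)\<inverse>, tail = fst, head = snd\<rparr>"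

lemma spider_vert_0 [simp]: "spider_vert i 0 = (0, 0)"
  and spider_vert_pos: "0 < j \<Longrightarrow> spider_vert i j = (i, j)"
  by (simp_all add: spider_vert_def)

lemma snd_spider_vert [simp]: "snd (spider_vert i j) = j"
  by (simp add: spider_vert_def)

lemma spider_vert_eq_iff:
  "spider_vert i j = spider_vert i' j' \<longleftrightarrow> j = j' \<and> (j = 0 \<or> i = i')"
  by (auto simp: spider_vert_def)

lemma verts_spider: "verts (spider ls) = {spider_vert i j | i j. i < length ls \<and> j \<le> ls ! i}"
  by (simp add: spider_def)

lemma arcs_ends_spider: "arcs_ends (spider ls) = spider_edges ls \<union> (spider_edges ls)\<inverse>"
  by (simp add: arcs_ends_conv spider_def)

lemma verts_spider_eq:
  assumes "ls \<noteq> []"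
  shows "verts (spider ls) = insert (0, 0) (SIGMA i:{..<length ls}. {1..ls ! i})"
proof (intro equalityI subsetI)
  fix v assume "v \<in> verts (spider ls)"
  then show "v \<in> insert (0, 0) (SIGMA i:{..<length ls}. {1..ls ! i})"
    by (auto simp: verts_spider spider_vert_def Suc_le_eq split: if_splits)
next
  fix v assume "v \<in> insert (0, 0) (SIGMA i:{..<length ls}. {1..ls ! i})"
  then consider "v = (0, 0)" | i j where "v = (i, j)" "i < length ls" "0 < j" "j \<le> ls ! i"
    by auto
  then show "v \<in> verts (spider ls)"
  proof cases
    case 1
    then have "v = spider_vert 0 0 \<and> 0 < length ls \<and> 0 \<le> ls ! 0"
      using assms by simp
    then show ?thesis
      unfolding verts_spider by blast
  next
    case 2
    then have "v = spider_vert i j \<and> i < length ls \<and> j \<le> ls ! i"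
      by (simp add: spider_vert_pos)
    then show ?thesis
      unfolding verts_spider by blast
  qed
qed

lemma sum_verts_spider:
  assumes "ls \<noteq> []"
  shows "(\<Sum>v\<in>verts (spider ls). F v)
    = F (0, 0) + (\<Sum>i<length ls. \<Sum>j = 1..ls ! i. F (i, j))"
  unfolding verts_spider_eq[OF assms] by (subst sum.insert) (auto simp: sum.Sigma)

lemma card_verts_spider:
  assumes "ls \<noteq> []"
  shows "card (verts (spider ls)) = Suc (sum_list ls)"
proof -
  have "card (verts (spider ls)) = (\<Sum>v\<in>verts (spider ls). 1)"
    by simp
  also have "\<dots> = Suc (sum_list ls)"
    unfolding sum_verts_spider[OF assms] by (simp add: sum_list_sum_nth atLeast0LessThan)
  finally show ?thesis .
qed

lemma graph_spider: "graph (spider ls)"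
proof -
  let ?S = "spider ls"
  have verts: "finite (verts ?S)"
  proof -
    have "verts ?S \<subseteq> (\<lambda>(i, j). spider_vert i j) ` (SIGMA i:{..<length ls}. {..ls ! i})"
      by (auto simp: verts_spider)
    then show ?thesis
      by (rule finite_subset) auto
  qed
  have wf: "e \<in> arcs ?S \<Longrightarrow> fst e \<in> verts ?S \<and> snd e \<in> verts ?S" for e
    by (auto simp: spider_def spider_edges_def) (metis Suc_leI less_imp_le)+
  then have "arcs ?S \<subseteq> verts ?S \<times> verts ?S"
    by (auto simp: mem_Times_iff)
  then have "finite (arcs ?S)"
    using verts by (meson finite_SigmaI finite_subset)
  moreover have "symmetric (spider ls)"
    by (simp add: symmetric_def arcs_ends_spider sym_Un_converse)
  moreover have "fst e \<noteq> snd e" if "e \<in> arcs ?S" for e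
    using that by (auto simp: spider_def spider_edges_def spider_vert_eq_iff)
  moreover have [simp]: "tail ?S = fst" "head ?S = snd"
    by (simp_all add: spider_def)
  ultimately show ?thesis
    using wf verts by unfold_locales (auto simp: arc_to_ends_def)
qed

lemma spider_edgeI:
  assumes "i < length ls" "j < ls ! i"
  shows "(spider_vert i j, spider_vert i (Suc j)) \<in> arcs_ends (spider ls)"
    and "(spider_vert i (Suc j), spider_vert i j) \<in> arcs_ends (spider ls)"
  using assms by (auto simp: arcs_ends_spider spider_edges_def)

lemma spider_edgeE:
  assumes "(u, v) \<in> arcs_ends (spider ls)"
  obtains i j where "i < length ls" "j < ls ! i"
    "u = spider_vert i j \<and> v = spider_vert i (Suc j) \<or> u = spider_vert i (Suc j) \<and> v = spider_vert i j"
  using assms by (auto simp: arcs_ends_spider spider_edges_def)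

text \<open>
  The two descriptions of neighbourhoods below are what makes paths in a spider rigid: a path that
  enters a vertex other than the root has at most one way to go on.
\<close>
lemma spider_root_adj_iff:
  "((0, 0), x) \<in> arcs_ends (spider ls) \<longleftrightarrow> (\<exists>i<length ls. 0 < ls ! i \<and> x = (i, 1))"
proof
  assume "((0, 0), x) \<in> arcs_ends (spider ls)"
  then show "\<exists>i<length ls. 0 < ls ! i \<and> x = (i, 1)"
    by (rule spider_edgeE) (auto simp: spider_vert_def split: if_splits)
next
  assume "\<exists>i<length ls. 0 < ls ! i \<and> x = (i, 1)"
  then obtain i where "i < length ls" "0 < ls ! i" "x = (i, 1)"
    by blast
  then show "((0, 0), x) \<in> arcs_ends (spider ls)"
    using spider_edgeI(1)[of i ls 0] by (simp add: spider_vert_def)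
qed

lemma spider_leg_adj_iff:
  assumes "i < length ls" "0 < j" "j \<le> ls ! i"
  shows "(spider_vert i j, x) \<in> arcs_ends (spider ls) \<longleftrightarrow>
    x = spider_vert i (j - 1) \<or> j < ls ! i \<and> x = spider_vert i (Suc j)"
proof
  assume "(spider_vert i j, x) \<in> arcs_ends (spider ls)"
  then show "x = spider_vert i (j - 1) \<or> j < ls ! i \<and> x = spider_vert i (Suc j)"
    using assms by (elim spider_edgeE) (auto simp: spider_vert_eq_iff)
next
  assume "x = spider_vert i (j - 1) \<or> j < ls ! i \<and> x = spider_vert i (Suc j)"
  then show "(spider_vert i j, x) \<in> arcs_ends (spider ls)"
    using assms spider_edgeI(1)[of i ls j] spider_edgeI(2)[of i ls "j - 1"] by auto
qed

definition spider_degree :: "nat list \<Rightarrow> nat \<times> nat \<Rightarrow> nat" where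
  "spider_degree ls v =
     (if snd v = 0 then length ls else if snd v = ls ! fst v then 1 else 2)"

lemma out_degree_spider:
  assumes pos: "0 \<notin> set ls" and v: "v \<in> verts (spider ls)"
  shows "out_degree (spider ls) v = spider_degree ls v"
proof -
  obtain i j where ij: "v = spider_vert i j" "i < length ls" "j \<le> ls ! i"
    using v by (auto simp: verts_spider)
  have nth_pos: "0 < ls ! i" if "i < length ls" for i
    using pos that by (metis gr0I nth_mem)
  show ?thesis
  proof (cases "j = 0")
    case True
    have "{w. ((0, 0), w) \<in> arcs_ends (spider ls)} = (\<lambda>i. (i, 1)) ` {..<length ls}"
      using nth_pos by (auto simp: spider_root_adj_iff)
    moreover have "inj_on (\<lambda>i. (i, 1 :: nat)) {..<length ls}"
      by (auto simp: inj_on_def)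
    ultimately show ?thesis
      using True ij
      by (simp add: out_degree_eq_card_neighbours[OF graph_spider] card_image spider_degree_def)
  next
    case False
    then have "{w. (v, w) \<in> arcs_ends (spider ls)} = (if j = ls ! i then {spider_vert i (j - 1)}
        else {spider_vert i (j - 1), spider_vert i (Suc j)})"
      using spider_leg_adj_iff[of i ls j] ij by auto
    then show ?thesis
      using False ij
      by (simp add: out_degree_eq_card_neighbours[OF graph_spider] spider_degree_def
          spider_vert_eq_iff) (simp add: spider_vert_def)
  qed
qed

text \<open>
  Reversal invariance of \<open>f\<close> is only available on positive tuples. Degrees in a graph isomorphic to
  a spider are positive because a leg vertex has a predecessor and the root has at least one leg.
\<close>
lemma path_sum_eq_order_invariant_spider:
  assumes G: "graph G" and iso: "adj_iso \<phi> (spider ls) G" and pos: "0 \<notin> set ls" and "ls \<noteq> []"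
    and sym: "\<And>xs. xs \<noteq> [] \<Longrightarrow> \<forall>x\<in>set xs. 1 \<le> x \<Longrightarrow> f xs = f (rev xs)"
  shows "path_sum f h G = (if h = 0 then 1 else 2) * order_invariant f h G"
proof (rule path_sum_eq_order_invariant[OF G])
  fix p assume p: "vpath p G"
  have "1 \<le> out_degree G v" if v: "v \<in> verts G" for v
  proof -
    have "v \<in> \<phi> ` verts (spider ls)"
      using iso v by (simp add: adj_iso_def bij_betw_def)
    then obtain w where w: "w \<in> verts (spider ls)" "v = \<phi> w"
      by blast
    then have "out_degree G v = spider_degree ls w"
      using adj_iso_out_degree[OF graph_spider G iso] out_degree_spider[OF pos] by simp
    then show ?thesis
      using \<open>ls \<noteq> []\<close> by (simp add: spider_degree_def Suc_le_eq)
  qed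
  then have "\<forall>x\<in>set (map (out_degree G) p). 1 \<le> x"
    using p by (auto simp: vpath_iff_nth)
  then show "f (rev (map (out_degree G) p)) = f (map (out_degree G) p)"
    using sym[of "map (out_degree G) p"] p by (simp add: vpath_iff_nth)
qed

section \<open>Paths in a spider\<close>
text \<open>
  The two shapes of a path of length \<open>h\<close> in a spider: it climbs a single leg \<open>i\<close> from distance \<open>j\<close>
  to distance \<open>j + h\<close>, or it comes down leg \<open>i\<close> from distance \<open>a\<close> to the root and goes up another
  leg \<open>i'\<close> to distance \<open>h - a\<close>. A path that starts at the root is of the first shape.
\<close>
definition leg_path :: "nat \<Rightarrow> nat \<Rightarrow> nat \<Rightarrow> (nat \<times> nat) list" where
  "leg_path h i j = map (spider_vert i) [j..<Suc (j + h)]"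

definition cross_path :: "nat \<Rightarrow> nat \<Rightarrow> nat \<Rightarrow> nat \<Rightarrow> (nat \<times> nat) list" where
  "cross_path h i i' a =
     map (spider_vert i) (rev [1..<Suc a]) @ map (spider_vert i') [0..<Suc (h - a)]"

definition leg_path_index :: "nat \<Rightarrow> nat list \<Rightarrow> (nat \<times> nat) set" where
  "leg_path_index h ls = {(i, j). i < length ls \<and> j + h \<le> ls ! i}"

definition cross_path_index :: "nat \<Rightarrow> nat list \<Rightarrow> (nat \<times> nat \<times> nat) set" where
  "cross_path_index h ls = {(i, i', a). i < length ls \<and> i' < length ls \<and> i \<noteq> i' \<and>
     1 \<le> a \<and> a < h \<and> a \<le> ls ! i \<and> h - a \<le> ls ! i'}"

lemma length_leg_path [simp]: "length (leg_path h i j) = Suc h"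
  by (simp add: leg_path_def)

lemma length_cross_path [simp]: "a < h \<Longrightarrow> length (cross_path h i i' a) = Suc h"
  by (simp add: cross_path_def del: upt_Suc)

lemma leg_path_Suc: "leg_path (Suc h) i j = leg_path h i j @ [spider_vert i (Suc (j + h))]"
  by (simp add: leg_path_def)

lemma leg_path_Suc_Cons: "leg_path (Suc h) i j = spider_vert i j # leg_path h i (Suc j)"
  unfolding leg_path_def by (subst upt_conv_Cons) auto

lemma cross_path_Suc:
  "a \<le> h \<Longrightarrow> cross_path (Suc h) i i' a = cross_path h i i' a @ [spider_vert i' (Suc (h - a))]"
  by (simp add: cross_path_def Suc_diff_le)

lemma last_leg_path [simp]: "last (leg_path h i j) = spider_vert i (j + h)"
  by (simp add: leg_path_def)

lemma hd_leg_path [simp]: "hd (leg_path h i j) = spider_vert i j"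
  by (simp add: leg_path_def hd_map del: upt_Suc)

lemma last_cross_path [simp]: "last (cross_path h i i' a) = spider_vert i' (h - a)"
  by (simp add: cross_path_def)

lemma hd_cross_path: "1 \<le> a \<Longrightarrow> hd (cross_path h i i' a) = spider_vert i a"
  by (cases a) (simp_all add: cross_path_def)

lemma leg_path_nonempty [simp]: "leg_path h i j \<noteq> []"
  by (simp add: leg_path_def)

lemma cross_path_nonempty [simp]: "cross_path h i i' a \<noteq> []"
  by (simp add: cross_path_def)

lemma vpath_leg_path:
  assumes "i < length ls" "j + h \<le> ls ! i"
  shows "vpath (leg_path h i j) (spider ls)"
  using assms(2)
proof (induction h)
  case 0
  then show ?case
    using assms(1) by (auto simp: leg_path_def vpath_iff_nth verts_spider)
next
  case (Suc h)
  have "spider_vert i (Suc (j + h)) \<notin> set (leg_path h i j)"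
    by (auto simp: leg_path_def spider_vert_eq_iff)
  moreover have "(last (leg_path h i j), spider_vert i (Suc (j + h))) \<in> arcs_ends (spider ls)"
    using spider_edgeI(1)[of i ls "j + h"] assms(1) Suc.prems by simp
  ultimately show ?case
    using Suc arcs_ends_in_verts[OF graph_spider]
    by (simp add: leg_path_Suc vpath_snoc_iff)
qed

text \<open>
  The degenerate crossing path that stops at the root is a leg path run downwards. This is how the
  second shape arises when a path is prolonged step by step.
\<close>
lemma cross_path_start: "cross_path h i i' h = rev (leg_path h i 0)"
proof -
  have "leg_path h i 0 = spider_vert i 0 # map (spider_vert i) [1..<Suc h]"
    unfolding leg_path_def by (subst upt_conv_Cons) (auto simp del: upt_Suc)
  then show ?thesis
    by (simp add: cross_path_def rev_map del: upt_Suc) simp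
qed

lemma vpath_cross_path:
  assumes "i < length ls" "i' < length ls" "i \<noteq> i'" "a \<le> ls ! i"
  shows "d \<le> ls ! i' \<Longrightarrow> vpath (cross_path (a + d) i i' a) (spider ls)"
proof (induction d)
  case 0
  then show ?case
    using assms vpath_leg_path[of i ls 0 a] by (simp add: cross_path_start vpath_rev[OF graph_spider])
next
  case (Suc d)
  have "spider_vert i' (Suc d) \<notin> set (cross_path (a + d) i i' a)"
    using assms(3) by (auto simp: cross_path_def spider_vert_eq_iff)
  moreover have "(last (cross_path (a + d) i i' a), spider_vert i' (Suc d)) \<in> arcs_ends (spider ls)"
    using spider_edgeI(1)[of i' ls d] assms(2) Suc.prems by simp
  ultimately show ?case
    using Suc arcs_ends_in_verts[OF graph_spider]
    by (simp add: cross_path_Suc vpath_snoc_iff)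
qed

text \<open>
  By induction on the length, prolonging the path at its end. The new vertex must avoid the
  last vertex but one, which leaves a single continuation everywhere except at the root; there the
  path turns into another leg and becomes a crossing path.
\<close>
lemma spider_vpath_cases:
  assumes "vpath p (spider ls)" "length p = Suc h" "0 < h"
  shows "(\<exists>(i, j) \<in> leg_path_index h ls. p = leg_path h i j \<or> p = rev (leg_path h i j)) \<or>
    (\<exists>(i, i', a) \<in> cross_path_index h ls. p = cross_path h i i' a)"
  using assms(3,1,2)
proof (induction h arbitrary: p rule: nat_induct_non_zero)
  case 1
  then obtain u v where p: "p = [u, v]"
    by (auto simp: length_Suc_conv numeral_2_eq_2)
  then have "(u, v) \<in> arcs_ends (spider ls)"
    using 1 by (auto simp: vpath_iff_nth)
  then show ?case
  proof (rule spider_edgeE)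
    fix i j
    assume "i < length ls" "j < ls ! i"
      and "u = spider_vert i j \<and> v = spider_vert i (Suc j) \<or>
        u = spider_vert i (Suc j) \<and> v = spider_vert i j"
    then have "(i, j) \<in> leg_path_index 1 ls" "p = leg_path 1 i j \<or> p = rev (leg_path 1 i j)"
      by (auto simp: p leg_path_index_def leg_path_def)
    then show ?thesis
      by blast
  qed
next
  case (Suc h)
  obtain q x where p: "p = q @ [x]" and q: "length q = Suc h"
    using Suc.prems(2) by (auto simp: length_Suc_conv_rev)
  then have "q \<noteq> []"
    by auto
  then have path: "vpath q (spider ls)" and x: "x \<notin> set q" "(last q, x) \<in> arcs_ends (spider ls)"
    using Suc.prems(1) by (simp_all add: p vpath_snoc_iff)
  consider (up) i j where "i < length ls" "j + h \<le> ls ! i" "q = leg_path h i j"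
    | (down) i j where "i < length ls" "j + h \<le> ls ! i" "q = rev (leg_path h i j)"
    | (cross) i i' a where "(i, i', a) \<in> cross_path_index h ls" "q = cross_path h i i' a"
    using Suc.IH[OF path q] by (auto simp: leg_path_index_def)
  then show ?case
  proof cases
    case up
    have "spider_vert i (j + h - 1) \<in> set q"
      using up(3) \<open>0 < h\<close> by (auto simp: leg_path_def)
    then have "j + h < ls ! i \<and> x = spider_vert i (Suc (j + h))"
      using spider_leg_adj_iff[of i ls "j + h" x] up x \<open>0 < h\<close> by auto
    then have "(i, j) \<in> leg_path_index (Suc h) ls" "p = leg_path (Suc h) i j"
      using up by (auto simp: leg_path_index_def leg_path_Suc p)
    then show ?thesis
      by blast
  next
    case down
    have adj: "(spider_vert i j, x) \<in> arcs_ends (spider ls)"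
      using x(2) down(3) by (simp add: last_rev)
    have next_in: "spider_vert i (Suc j) \<in> set q"
      using down(3) \<open>0 < h\<close> by (auto simp: leg_path_def simp del: upt_Suc)
    show ?thesis
    proof (cases j)
      case 0
      then obtain i' where i': "i' < length ls" "0 < ls ! i'" "x = spider_vert i' 1"
        using adj by (auto simp: spider_root_adj_iff spider_vert_def)
      then have "i' \<noteq> i"
        using next_in x 0 by auto
      then have "(i, i', h) \<in> cross_path_index (Suc h) ls"
        using i' down \<open>0 < h\<close> by (auto simp: cross_path_index_def)
      moreover have "p = cross_path (Suc h) i i' h"
        using i' down 0 by (simp add: p cross_path_Suc cross_path_start)
      ultimately show ?thesis
        by blast
    next
      case (Suc j')
      then have "x = spider_vert i j'"
        using spider_leg_adj_iff[of i ls j x] adj down x next_in by auto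
      then have "p = rev (leg_path (Suc h) i j')" "(i, j') \<in> leg_path_index (Suc h) ls"
        using down Suc by (auto simp: p leg_path_Suc_Cons leg_path_index_def)
      then show ?thesis
        by blast
    qed
  next
    case cross
    then have idx: "i < length ls" "i' < length ls" "i \<noteq> i'" "1 \<le> a" "a < h" "a \<le> ls ! i" "h - a \<le> ls ! i'"
      by (auto simp: cross_path_index_def)
    have "spider_vert i' (h - a - 1) \<in> set q"
      using cross(2) idx by (auto simp: cross_path_def)
    then have "h - a < ls ! i' \<and> x = spider_vert i' (Suc (h - a))"
      using spider_leg_adj_iff[of i' ls "h - a" x] idx cross x by auto
    then have "(i, i', a) \<in> cross_path_index (Suc h) ls" "p = cross_path (Suc h) i i' a"
      using idx cross by (auto simp: cross_path_index_def cross_path_Suc p)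
    then show ?thesis
      by blast
  qed
qed

lemma finite_leg_path_index: "finite (leg_path_index h ls)"
proof -
  have "leg_path_index h ls \<subseteq> (SIGMA i:{..<length ls}. {..ls ! i})"
    by (auto simp: leg_path_index_def)
  then show ?thesis
    by (rule finite_subset) auto
qed

lemma finite_cross_path_index: "finite (cross_path_index h ls)"
proof -
  have "cross_path_index h ls \<subseteq> {..<length ls} \<times> {..<length ls} \<times> {..<h}"
    by (auto simp: cross_path_index_def)
  then show ?thesis
    by (rule finite_subset) auto
qed

text \<open>
  The three families of oriented paths (up a leg, down a leg, across the root) are disjoint, and the
  members of each family are determined by their end points: going up a leg the distance from the
  root increases, going down it decreases, and a crossing path ends on two different legs, away from
  the root. Reversal swaps the first two families and therefore gives the factor \<open>2\<close>. The index set
  of crossing paths contains both orientations of each.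
\<close>
lemma path_sum_spider:
  assumes pos: "0 \<notin> set ls" and "ls \<noteq> []" and "0 < h"
    and sym: "\<And>xs. xs \<noteq> [] \<Longrightarrow> \<forall>x\<in>set xs. 1 \<le> x \<Longrightarrow> f xs = f (rev xs)"
  shows "path_sum f h (spider ls) =
      2 * (\<Sum>(i, j)\<in>leg_path_index h ls. f (map (spider_degree ls) (leg_path h i j)))
      + (\<Sum>(i, i', a)\<in>cross_path_index h ls. f (map (spider_degree ls) (cross_path h i i' a)))"
proof -
  let ?F = "\<lambda>p. f (map (spider_degree ls) p)"
  define A where "A = (\<lambda>(i, j). leg_path h i j) ` leg_path_index h ls"
  define B where "B = (\<lambda>(i, i', a). cross_path h i i' a) ` cross_path_index h ls"
  have fin: "finite A" "finite B"
    by (simp_all add: A_def B_def finite_leg_path_index finite_cross_path_index)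
  have "{p. vpath p (spider ls) \<and> vwalk_length p = h} = A \<union> rev ` A \<union> B"
  proof (intro equalityI subsetI)
    fix p assume "p \<in> {p. vpath p (spider ls) \<and> vwalk_length p = h}"
    then have "vpath p (spider ls)" "length p = Suc h"
      using \<open>0 < h\<close> by auto
    then consider i j where "(i, j) \<in> leg_path_index h ls" "p = leg_path h i j"
      | i j where "(i, j) \<in> leg_path_index h ls" "p = rev (leg_path h i j)"
      | i i' a where "(i, i', a) \<in> cross_path_index h ls" "p = cross_path h i i' a"
      using spider_vpath_cases[OF _ _ \<open>0 < h\<close>] by blast
    then show "p \<in> A \<union> rev ` A \<union> B"
    proof cases
      case 1
      then have "p \<in> A"
        unfolding A_def by (auto intro: rev_image_eqI)
      then show ?thesis by blast
    next
      case 2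
      then have "rev p \<in> A"
        unfolding A_def by (auto intro: rev_image_eqI)
      then show ?thesis
        by (metis UnI1 UnI2 image_eqI rev_rev_ident)
    next
      case 3
      then have "p \<in> B"
        unfolding B_def by (auto intro: rev_image_eqI)
      then show ?thesis by blast
    qed
  next
    have A: "vpath p (spider ls) \<and> vwalk_length p = h" if "p \<in> A" for p
      using that by (auto simp: A_def leg_path_index_def vpath_leg_path)
    have B: "vpath p (spider ls) \<and> vwalk_length p = h" if "p \<in> B" for p
    proof -
      obtain i i' a where *: "(i, i', a) \<in> cross_path_index h ls" "p = cross_path h i i' a"
        using \<open>p \<in> B\<close> by (auto simp: B_def)
      then show ?thesis
        using vpath_cross_path[of i ls i' a "h - a"] by (auto simp: cross_path_index_def)
    qed
    fix p assume "p \<in> A \<union> rev ` A \<union> B"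
    then show "p \<in> {p. vpath p (spider ls) \<and> vwalk_length p = h}"
      using A B by (auto simp: vpath_rev[OF graph_spider])
  qed
  moreover have "f (map (out_degree (spider ls)) p) = ?F p" if "vpath p (spider ls)" for p
  proof -
    have "map (out_degree (spider ls)) p = map (spider_degree ls) p"
      using that out_degree_spider[OF pos] by (auto simp: vpath_iff_nth)
    then show ?thesis
      by (rule arg_cong)
  qed
  ultimately have "path_sum f h (spider ls) = sum ?F (A \<union> rev ` A \<union> B)"
    unfolding path_sum_def by (intro sum.cong) auto
  also have "\<dots> = sum ?F A + sum ?F (rev ` A) + sum ?F B"
  proof -
    have A: "snd (hd p) < snd (last p)" "snd (hd p) = 0 \<or> fst (hd p) = fst (last p)"
      if p: "p \<in> A" for p
      using p \<open>0 < h\<close> by (auto simp: A_def spider_vert_def split: if_splits)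
    have revA: "snd (last p) < snd (hd p)" "snd (last p) = 0 \<or> fst (hd p) = fst (last p)"
      if p: "p \<in> rev ` A" for p
    proof -
      obtain q where q: "p = rev q" "q \<in> A"
        using p by blast
      then have "q \<noteq> []"
        by (auto simp: A_def)
      then show "snd (last p) < snd (hd p)" "snd (last p) = 0 \<or> fst (hd p) = fst (last p)"
        using A[of q] q by (auto simp: hd_rev last_rev)
    qed
    have B: "0 < snd (hd p)" "0 < snd (last p)" "fst (hd p) \<noteq> fst (last p)" if "p \<in> B" for p
      using that by (auto simp: B_def cross_path_index_def hd_cross_path spider_vert_def)
    have "A \<inter> rev ` A = {}"
      using A(1) revA(1) by (meson disjoint_iff less_asym)
    moreover have "(A \<union> rev ` A) \<inter> B = {}"
    proof -
      have "p \<notin> B" if "p \<in> A \<union> rev ` A" for p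
        using that A(2)[of p] revA(2)[of p] B[of p] by (elim UnE) auto
      then show ?thesis by blast
    qed
    ultimately show ?thesis
      using fin by (simp add: sum.union_disjoint)
  qed
  also have "sum ?F (rev ` A) = sum ?F A"
  proof -
    have "?F (rev p) = ?F p" if p: "p \<in> A" for p
    proof -
      have "\<forall>x\<in>set (map (spider_degree ls) p). 1 \<le> x"
        using \<open>ls \<noteq> []\<close> by (auto simp: spider_degree_def Suc_le_eq)
      then show ?thesis
        using sym[of "map (spider_degree ls) p"] p by (auto simp: rev_map A_def)
    qed
    then show ?thesis
      by (simp add: sum.reindex cong: sum.cong)
  qed
  also have "sum ?F A = (\<Sum>(i, j)\<in>leg_path_index h ls. ?F (leg_path h i j))"
  proof -
    have "inj_on (\<lambda>(i, j). leg_path h i j) (leg_path_index h ls)"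
    proof (rule inj_onI, clarify)
      fix i j i' j' assume "leg_path h i j = leg_path h i' j'"
      then have "spider_vert i (j + h) = spider_vert i' (j' + h)"
        by (metis last_leg_path)
      then show "i = i' \<and> j = j'"
        using \<open>0 < h\<close> by (simp add: spider_vert_eq_iff)
    qed
    then show ?thesis
      unfolding A_def by (simp add: sum.reindex case_prod_unfold)
  qed
  also have "sum ?F B = (\<Sum>(i, i', a)\<in>cross_path_index h ls. ?F (cross_path h i i' a))"
  proof -
    have "inj_on (\<lambda>(i, i', a). cross_path h i i' a) (cross_path_index h ls)"
    proof (rule inj_onI)
      fix x y
      assume xy: "x \<in> cross_path_index h ls" "y \<in> cross_path_index h ls"
        and paths: "(\<lambda>(i, i', a). cross_path h i i' a) x = (\<lambda>(i, i', a). cross_path h i i' a) y"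
      obtain i j a i' j' a' where [simp]: "x = (i, j, a)" "y = (i', j', a')"
        by (metis prod_cases3)
      have eq: "cross_path h i j a = cross_path h i' j' a'"
        using paths by simp
      have "spider_vert i a = spider_vert i' a'"
        using xy arg_cong[OF eq, of hd] by (simp add: cross_path_index_def hd_cross_path)
      moreover have "spider_vert j (h - a) = spider_vert j' (h - a')"
        using arg_cong[OF eq, of last] by simp
      ultimately show "x = y"
        using xy by (auto simp: spider_vert_eq_iff cross_path_index_def)
    qed
    then show ?thesis
      unfolding B_def by (simp add: sum.reindex case_prod_unfold)
  qed
  finally show ?thesis
    by simp
qed

text \<open>
  A crossing path of length \<open>h\<close> has \<open>a\<close> and \<open>h - a\<close> both positive, so it only reaches
  distances below \<open>h\<close> and cannot tell whether a leg has length \<open>h\<close> or more.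
\<close>
lemma cross_sum_truncate:
  "(\<Sum>(i, i', a)\<in>cross_path_index h ls. f (map (spider_degree ls) (cross_path h i i' a))) =
   (\<Sum>(i, i', a)\<in>cross_path_index h (map (min h) ls).
      f (map (spider_degree (map (min h) ls)) (cross_path h i i' a)))"
proof (rule sum.cong)
  show "cross_path_index h ls = cross_path_index h (map (min h) ls)"
    by (auto simp: cross_path_index_def)
next
  fix x assume "x \<in> cross_path_index h (map (min h) ls)"
  then obtain i i' a where x: "x = (i, i', a)" "i < length ls" "i' < length ls" "1 \<le> a" "a < h"
    by (auto simp: cross_path_index_def)
  have "spider_degree ls v = spider_degree (map (min h) ls) v" if "v \<in> set (cross_path h i i' a)" for v
  proof -
    obtain l t where "v = spider_vert l t" "l < length ls" "t < h"
      using \<open>v \<in> _\<close> x by (auto simp: cross_path_def simp del: upt_Suc)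
    then show ?thesis
      by (auto simp: spider_degree_def spider_vert_def)
  qed
  then have "map (spider_degree ls) (cross_path h i i' a)
      = map (spider_degree (map (min h) ls)) (cross_path h i i' a)"
    by auto
  then show "(case x of (i, i', a) \<Rightarrow> f (map (spider_degree ls) (cross_path h i i' a))) =
    (case x of (i, i', a) \<Rightarrow> f (map (spider_degree (map (min h) ls)) (cross_path h i i' a)))"
    unfolding x prod.case by (rule arg_cong)
qed

section \<open>The contribution of a single leg\<close>
text \<open>
  The contribution of the paths that climb a leg of length \<open>l\<close> in a spider with \<open>k\<close> legs.
\<close>
definition leg_sum :: "(nat list \<Rightarrow> real) \<Rightarrow> nat \<Rightarrow> nat \<Rightarrow> nat \<Rightarrow> real" where
  "leg_sum f k h l = (\<Sum>j | j + h \<le> l.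
     f (map (\<lambda>t. if t = 0 then k else if t = l then 1 else 2) [j..<Suc (j + h)]))"

lemma sum_leg_paths:
  "(\<Sum>(i, j)\<in>leg_path_index h ls. f (map (spider_degree ls) (leg_path h i j)))
     = (\<Sum>l\<in>#mset ls. leg_sum f (length ls) h l)"
proof -
  have fin: "finite {j. j + h \<le> l}" for l :: nat
    by (rule finite_subset[of _ "{..l}"]) auto
  have "leg_path_index h ls = (SIGMA i:{..<length ls}. {j. j + h \<le> ls ! i})"
    by (auto simp: leg_path_index_def)
  then have "(\<Sum>(i, j)\<in>leg_path_index h ls. f (map (spider_degree ls) (leg_path h i j)))
     = (\<Sum>i<length ls. \<Sum>j | j + h \<le> ls ! i. f (map (spider_degree ls) (leg_path h i j)))"
    using fin by (simp add: sum.Sigma)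
  also have "\<dots> = (\<Sum>i<length ls. leg_sum f (length ls) h (ls ! i))"
    unfolding leg_sum_def
  proof (intro sum.cong refl arg_cong[where f = f])
    fix i j
    have "spider_degree ls (spider_vert i t)
        = (if t = 0 then length ls else if t = ls ! i then 1 else 2)" for t
      by (auto simp: spider_degree_def spider_vert_def)
    then show "map (spider_degree ls) (leg_path h i j) =
        map (\<lambda>t. if t = 0 then length ls else if t = ls ! i then 1 else 2) [j..<Suc (j + h)]"
      unfolding leg_path_def map_map by (intro map_cong) auto
  qed
  also have "\<dots> = (\<Sum>l\<in>#mset ls. leg_sum f (length ls) h l)"
    by (simp add: sum_list_sum_nth atLeast0LessThan sum_mset_sum_list flip: mset_map)
  finally show ?thesis .
qed

lemma map_upt_degrees:
  assumes "\<And>t. a \<le> t \<Longrightarrow> t < b \<Longrightarrow> d t = 2"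
  shows "map d [a..<b] = replicate (b - a) 2"
  using assms by (intro nth_equalityI) auto

lemma leg_sum_exact:
  assumes "0 < h"
  shows "leg_sum f k h h = f (k # replicate (h - 1) 2 @ [1])"
proof -
  have "{j. j + h \<le> h} = {0}"
    by auto
  moreover have "[0..<Suc h] = 0 # [1..<h] @ [h]"
    using assms by (simp add: upt_conv_Cons)
  ultimately show ?thesis
    using assms by (simp add: leg_sum_def map_upt_degrees del: upt_Suc)
qed

text \<open>
  Besides the path that starts at the root and the one that ends at the leaf, there are
  \<open>l - h - 1\<close> paths which run through vertices of degree \<open>2\<close> only.
\<close>
lemma leg_sum_long:
  assumes "0 < h" "h < l"
  shows "leg_sum f k h l = f (k # replicate h 2) + f (replicate h 2 @ [1])
    + (real l - real h - 1) * f (replicate (Suc h) 2)"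
proof -
  define G where "G j = f (map (\<lambda>t. if t = 0 then k else if t = l then 1 else 2) [j..<Suc (j + h)])" for j
  have "{j. j + h \<le> l} = insert 0 (insert (l - h) {1..<l - h})"
    using assms by auto
  then have "leg_sum f k h l = G 0 + (G (l - h) + sum G {1..<l - h})"
    using assms by (simp add: leg_sum_def G_def del: upt_Suc)
  moreover have "G 0 = f (k # replicate h 2)"
  proof -
    have "[0..<Suc h] = 0 # [1..<Suc h]"
      by (simp add: upt_conv_Cons del: upt_Suc)
    then show ?thesis
      using assms by (simp add: G_def map_upt_degrees del: upt_Suc)
  qed
  moreover have "G (l - h) = f (replicate h 2 @ [1])"
  proof -
    have "map (\<lambda>t. if t = 0 then k else if t = l then 1 else 2) [l - h..<l] = replicate (l - (l - h)) 2"
      using assms by (intro map_upt_degrees) auto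
    then show ?thesis
      using assms by (simp add: G_def)
  qed
  moreover have "G j = f (replicate (Suc h) 2)" if "j \<in> {1..<l - h}" for j
  proof -
    have "map (\<lambda>t. if t = 0 then k else if t = l then 1 else 2) [j..<Suc (j + h)]
        = replicate (Suc (j + h) - j) 2"
      using that by (intro map_upt_degrees) auto
    then show ?thesis
      by (simp only: G_def) simp
  qed
  ultimately show ?thesis
    using assms by (simp add: of_nat_diff)
qed

lemma sum_mset_eq_sum_count:
  fixes e :: "nat \<Rightarrow> real"
  assumes "\<And>l. h < l \<Longrightarrow> e l = 0"
  shows "(\<Sum>l\<in>#M. e l) = (\<Sum>j\<le>h. real (count M j) * e j)"
proof (induction M)
  case (add x M)
  have "(\<Sum>j\<le>h. real (count (add_mset x M) j) * e j)
      = (\<Sum>j\<le>h. real (count M j) * e j + (if j = x then e j else 0))"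
    by (intro sum.cong) (auto simp: algebra_simps)
  then show ?case
    using add assms[of x] by (simp add: sum.distrib)
qed simp

text \<open>
  The multiplicities below \<open>h\<close> and the total number determine how many elements are at least \<open>h\<close>.
\<close>
lemma image_mset_min_cong:
  fixes M M' :: "nat multiset"
  assumes size: "size M = size M'" and count: "\<And>j. j < h \<Longrightarrow> count M j = count M' j"
  shows "image_mset (min h) M = image_mset (min h) M'"
proof -
  have split: "image_mset (min h) N =
      filter_mset (\<lambda>l. l < h) N + replicate_mset (size N - size (filter_mset (\<lambda>l. l < h) N)) h"
    for N :: "nat multiset"
  proof (induction N)
    case (add x N)
    have "size (filter_mset (\<lambda>l. l < h) N) \<le> size N"
      by (simp add: size_filter_mset_lesseq)
    with add show ?case
      by (auto simp: Suc_diff_le)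
  qed simp
  have "filter_mset (\<lambda>l. l < h) M = filter_mset (\<lambda>l. l < h) M'"
    by (rule multiset_eqI) (simp add: count)
  then show ?thesis
    using size by (simp add: split)
qed


text \<open>
  With \<open>k\<close> legs and \<open>m\<close> vertices besides the root there are \<open>k\<close> leaves, \<open>m - k\<close> vertices of degree
  \<open>2\<close> and one vertex of degree \<open>k\<close>.
\<close>
lemma path_sum_0_spider:
  assumes pos: "0 \<notin> set ls" and "ls \<noteq> []"
    and sym: "\<And>xs. xs \<noteq> [] \<Longrightarrow> \<forall>x\<in>set xs. 1 \<le> x \<Longrightarrow> f xs = f (rev xs)"
  shows "path_sum f 0 (spider ls) =
    f [length ls] + real (length ls) * (f [1] - f [2]) + real (sum_list ls) * f [2]"
proof -
  have "adj_iso id (spider ls) (spider ls)"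
    by (simp add: adj_iso_def)
  then have "path_sum f 0 (spider ls) = order_invariant f 0 (spider ls)"
    using path_sum_eq_order_invariant_spider[where f = f and h = 0, OF graph_spider _ pos \<open>ls \<noteq> []\<close> sym]
    by simp
  also have "\<dots> = (\<Sum>v\<in>verts (spider ls). f [spider_degree ls v])"
    by (simp add: order_invariant_0 out_degree_spider[OF pos])
  also have "\<dots> = f [length ls] + (\<Sum>i<length ls. \<Sum>j = 1..ls ! i. f [if j = ls ! i then 1 else 2])"
    by (simp add: sum_verts_spider[OF \<open>ls \<noteq> []\<close>] spider_degree_def)
  also have "(\<Sum>i<length ls. \<Sum>j = 1..ls ! i. f [if j = ls ! i then 1 else 2])
      = (\<Sum>i<length ls. f [1] - f [2] + real (ls ! i) * f [2])"
  proof (rule sum.cong[OF refl])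
    fix i assume "i \<in> {..<length ls}"
    then have "{1..ls ! i} = insert (ls ! i) {1..<ls ! i}" "0 < ls ! i"
      using pos by (auto simp: Suc_le_eq intro!: gr0I) (metis nth_mem)+
    then show "(\<Sum>j = 1..ls ! i. f [if j = ls ! i then 1 else 2])
        = f [1] - f [2] + real (ls ! i) * f [2]"
      by (simp add: of_nat_diff algebra_simps Suc_le_eq)
  qed
  also have "\<dots> = real (length ls) * (f [1] - f [2]) + real (sum_list ls) * f [2]"
    by (simp add: sum.distrib sum_distrib_right sum_list_sum_nth atLeast0LessThan)
  finally show ?thesis
    by simp
qed

section \<open>The invariants determine the leg lengths\<close>
text \<open>
  For \<open>l > h\<close> the contribution of a leg is an affine function of \<open>l\<close>. The sum of an affine function
  over all legs depends only on the number of legs and the number of vertices, so it can be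
  subtracted from the contribution of every leg, long or short; what remains vanishes on long legs.
\<close>
definition leg_excess :: "(nat list \<Rightarrow> real) \<Rightarrow> nat \<Rightarrow> nat \<Rightarrow> nat \<Rightarrow> real" where
  "leg_excess f k h l = leg_sum f k h l - (f (k # replicate h 2) + f (replicate h 2 @ [1]))
    - (real l - real h - 1) * f (replicate (Suc h) 2)"

lemma leg_excess_long: "0 < h \<Longrightarrow> h < l \<Longrightarrow> leg_excess f k h l = 0"
  by (simp add: leg_excess_def leg_sum_long)

text \<open>
  The path from the root ends in the leaf instead of a vertex of degree \<open>2\<close>, which gives \<open>g(k)\<close>.
  The other path that a longer leg has at its leaf is missing, and the number \<open>l - h - 1\<close> of inner
  paths is extrapolated to \<open>- 1\<close>; together this gives \<open>- g(2)\<close>. Condition (b) of the theorem says that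
  the two do not cancel.
\<close>
lemma leg_excess_exact:
  assumes "0 < h"
  shows "leg_excess f k h h = g_diff f (h - 1) k - g_diff f (h - 1) 2"
proof -
  obtain t where "h = Suc t"
    using assms by (metis gr0_implies_Suc)
  then show ?thesis
    using leg_sum_exact[OF assms] by (simp add: leg_excess_def g_diff_def)
qed

text \<open>
  Order \<open>0\<close> yields the number of legs: if two spiders with the same number of vertices had
  different degrees at the root, the difference quotient in (a) would equal \<open>f [2] - f [1]\<close>.
  Then order \<open>h\<close> yields the number of legs of length \<open>h\<close> once those of smaller length are known.
  Sorting the lengths makes the legs of two spiders that agree below \<open>h\<close> comparable index by index,
  so that their crossing paths contribute the same.
\<close>
lemma spider_leg_lengths_determined:
  assumes sorted: "sorted ls" "sorted ls'" and pos: "0 \<notin> set ls" "0 \<notin> set ls'"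
    and deg: "3 \<le> length ls" "3 \<le> length ls'" and total: "sum_list ls = sum_list ls'"
    and sym: "\<And>xs. xs \<noteq> [] \<Longrightarrow> \<forall>x\<in>set xs. 1 \<le> x \<Longrightarrow> f xs = f (rev xs)"
    and a: "\<And>x y :: nat. x \<ge> 3 \<Longrightarrow> y \<ge> 3 \<Longrightarrow> x \<noteq> y \<Longrightarrow>
              (f [x] - f [y]) / (real x - real y) \<noteq> f [2] - f [1]"
    and b: "\<And>x t :: nat. x \<ge> 1 \<Longrightarrow> x \<noteq> 2 \<Longrightarrow> g_diff f t x \<noteq> g_diff f t 2"
    and eq: "\<And>h. path_sum f h (spider ls) = path_sum f h (spider ls')"
  shows "ls = ls'"
proof -
  have nonempty: "ls \<noteq> []" "ls' \<noteq> []"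
    using deg by auto
  have k: "length ls = length ls'"
  proof (rule ccontr)
    assume "length ls \<noteq> length ls'"
    moreover have "f [length ls] - f [length ls']
        = (real (length ls) - real (length ls')) * (f [2] - f [1])"
      using eq[of 0] path_sum_0_spider[where f = f, OF pos(1) nonempty(1) sym]
        path_sum_0_spider[where f = f, OF pos(2) nonempty(2) sym] total
      by (simp add: algebra_simps)
    ultimately show False
      using a[OF deg] by (simp add: field_simps)
  qed
  define k where "k = length ls"
  have "count (mset ls) h = count (mset ls') h" for h
  proof (induction h rule: less_induct)
    case (less h)
    show ?case
    proof (cases "h = 0")
      case True
      have "count (mset ls) 0 = 0" "count (mset ls') 0 = 0"
        using pos by (simp_all add: count_eq_zero_iff del: count_mset)
      then show ?thesis
        by (simp only: True)
    next
      case False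
      then have "0 < h"
        by simp
      have "mset (map (min h) ls) = mset (map (min h) ls')"
        using image_mset_min_cong[of "mset ls" "mset ls'" h] k less by simp
      moreover have "sorted (map (min h) ls)" "sorted (map (min h) ls')"
        using sorted by (auto simp: sorted_map elim!: sorted_wrt_mono_rel[rotated])
      ultimately have trunc: "map (min h) ls = map (min h) ls'"
        by (metis properties_for_sort)
      have legs: "(\<Sum>l\<in>#mset ls. leg_sum f k h l) = (\<Sum>l\<in>#mset ls'. leg_sum f k h l)"
        using eq[of h] path_sum_spider[where f = f, OF pos(1) nonempty(1) \<open>0 < h\<close> sym]
          path_sum_spider[where f = f, OF pos(2) nonempty(2) \<open>0 < h\<close> sym]
          cross_sum_truncate[of f ls h] cross_sum_truncate[of f ls' h] trunc
        by (simp add: sum_leg_paths k_def k)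
      define e where "e = leg_excess f k h"
      have e_sum: "(\<Sum>l\<in>#mset xs. e l) = (\<Sum>l\<in>#mset xs. leg_sum f k h l)
          - real (length xs) * (f (k # replicate h 2) + f (replicate h 2 @ [1]))
          - (real (sum_list xs) - real (length xs) * (real h + 1)) * f (replicate (Suc h) 2)" for xs
        by (induction xs) (simp_all add: e_def leg_excess_def algebra_simps)
      have "(\<Sum>l\<in>#mset ls. e l) = (\<Sum>l\<in>#mset ls'. e l)"
        unfolding e_sum using legs total k by simp
      moreover have e_long: "h < l \<Longrightarrow> e l = 0" for l
        using leg_excess_long[OF \<open>0 < h\<close>] by (simp add: e_def)
      ultimately have "(\<Sum>j\<le>h. real (count (mset ls) j) * e j)
          = (\<Sum>j\<le>h. real (count (mset ls') j) * e j)"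
        by (simp add: sum_mset_eq_sum_count[of h e])
      moreover have "(\<Sum>j<h. real (count (mset ls) j) * e j) = (\<Sum>j<h. real (count (mset ls') j) * e j)"
        using less by (intro sum.cong) auto
      ultimately have "real (count (mset ls) h) * e h = real (count (mset ls') h) * e h"
        by (simp add: lessThan_Suc_atMost[symmetric])
      moreover have "e h \<noteq> 0"
        using leg_excess_exact[OF \<open>0 < h\<close>, of f k] b[of k "h - 1"] deg by (simp add: e_def k_def)
      ultimately show ?thesis
        by simp
    qed
  qed
  then have "mset ls = mset ls'"
    by (rule multiset_eqI)
  then show ?thesis
    using sorted by (metis properties_for_sort)
qed

section \<open>Starlike trees are spiders\<close>
text \<open>
  A leg is a path from \<open>r\<close> that can be left only through \<open>r\<close>: every neighbour of its other vertices
  is a neighbour along the path.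
\<close>
definition leg_from :: "('a, 'b) pre_digraph \<Rightarrow> 'a \<Rightarrow> 'a list \<Rightarrow> bool" where
  "leg_from G r p \<longleftrightarrow> vpath p G \<and> 2 \<le> length p \<and> p ! 0 = r \<and>
     (\<forall>j y. 0 < j \<longrightarrow> j < length p \<longrightarrow> (p ! j, y) \<in> arcs_ends G \<longrightarrow>
        y = p ! (j - 1) \<or> Suc j < length p \<and> y = p ! Suc j)"

text \<open>
  A longest path that starts with the edge from \<open>r\<close> to \<open>u\<close> is a leg. An inner vertex has degree at
  most \<open>2\<close>, so its neighbours are the two adjacent path vertices. All neighbours of the last vertex lie
  on the path, as it is longest, and one other than the predecessor would close a cycle.
\<close>
lemma exists_leg_from:
  assumes tree: "undirected_tree G"
    and deg: "\<And>v. v \<in> verts G \<Longrightarrow> v \<noteq> r \<Longrightarrow> out_degree G v \<le> 2"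
    and u: "(r, u) \<in> arcs_ends G"
  obtains p where "leg_from G r p" "p ! 1 = u"
proof -
  have G: "graph G" and acyclic: "\<And>p. \<not> undirected_cycle G p"
    using tree by (auto simp: undirected_tree_def)
  let ?Q = "{p. vpath p G \<and> 2 \<le> length p \<and> p ! 0 = r \<and> p ! 1 = u}"
  have "[r, u] \<in> ?Q"
    using u arcs_ends_in_verts[OF G u] arcs_ends_irrefl[OF G] by (auto simp: vpath_iff_nth)
  then have nonempty: "length ` ?Q \<noteq> {}"
    by blast
  have "finite ?Q"
    using finite_vpaths[OF G] by (rule rev_finite_subset) auto
  then have fin: "finite (length ` ?Q)"
    by (rule finite_imageI)
  obtain p where p: "p \<in> ?Q" and max: "Max (length ` ?Q) = length p"
    using Max_in[OF fin nonempty] by (rule imageE)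
  have longest: "length q \<le> length p" if "q \<in> ?Q" for q
    unfolding max[symmetric] using fin that by (intro Max_ge imageI)
  have path: "vpath p G" and len: "2 \<le> length p" and p0: "p ! 0 = r" and p1: "p ! 1 = u"
    using p by auto
  have distinct: "distinct p"
    and verts: "\<And>i. i < length p \<Longrightarrow> p ! i \<in> verts G"
    and edge: "\<And>i. Suc i < length p \<Longrightarrow> (p ! i, p ! Suc i) \<in> arcs_ends G"
    using path by (auto simp: vpath_iff_nth)
  have "y = p ! (j - 1) \<or> Suc j < length p \<and> y = p ! Suc j"
    if j: "0 < j" "j < length p" and y: "(p ! j, y) \<in> arcs_ends G" for j y
  proof (cases "Suc j < length p")
    case True
    let ?N = "{w. (p ! j, w) \<in> arcs_ends G}"
    have "p ! j \<noteq> r"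
      using distinct j p0 by (metis nth_eq_iff_index_eq less_trans not_less_iff_gr_or_eq)
    then have "card ?N \<le> 2"
      using deg[of "p ! j"] verts j by (simp add: out_degree_eq_card_neighbours[OF G])
    moreover have "{p ! (j - 1), p ! Suc j} \<subseteq> ?N"
      using edge[of "j - 1"] edge[of j] j True arcs_ends_sym[OF G] by auto
    moreover have "card {p ! (j - 1), p ! Suc j} = 2"
      using distinct j True by (simp add: nth_eq_iff_index_eq)
    moreover have "finite ?N"
      using arcs_ends_in_verts[OF G] fin_digraph.finite_verts[of G] G
      by (auto simp: graph_def digraph_def intro: rev_finite_subset)
    ultimately have "?N = {p ! (j - 1), p ! Suc j}"
      by (metis card_seteq)
    then show ?thesis
      using y True by auto
  next
    case False
    then have "j = length p - 1" and "p \<noteq> []"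
      using j by auto
    then have last: "j = length p - 1" "last p = p ! j"
      by (simp_all add: last_conv_nth)
    have "y \<in> set p"
    proof (rule ccontr)
      assume "y \<notin> set p"
      then have "p @ [y] \<in> ?Q"
        using path len p0 p1 y last arcs_ends_in_verts[OF G y]
        by (auto simp: vpath_snoc_iff nth_append)
      then show False
        using longest[of "p @ [y]"] by simp
    qed
    then obtain m where m: "m < length p" "y = p ! m"
      by (metis in_set_conv_nth)
    have "m \<noteq> j"
      using y m arcs_ends_irrefl[OF G] by auto
    have "undirected_cycle G (drop m p)" if "Suc m < j"
      using vpath_drop[OF path \<open>m < length p\<close>] that m y last
      by (simp add: undirected_cycle_def hd_drop_conv_nth)
    then have "\<not> Suc m < j"
      using acyclic by blast
    then have "m = j - 1"
      using m last \<open>m \<noteq> j\<close> by linarith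
    then show ?thesis
      using m by simp
  qed
  then have "leg_from G r p"
    using path len p0 by (simp add: leg_from_def)
  then show thesis
    using that p1 by blast
qed

text \<open>
  If two legs meet away from the root, the first can be followed back towards the root without ever
  leaving the second. Its vertex next to \<open>r\<close> then lies on the second leg, where only the first
  vertex after \<open>r\<close> is adjacent to \<open>r\<close>.
\<close>
lemma legs_meet_imp_same_start:
  assumes G: "graph G" and p: "leg_from G r p" and q: "leg_from G r q"
    and meet: "p ! i = q ! j" "0 < i" "i < length p" "0 < j" "j < length q"
  shows "p ! 1 = q ! 1"
  using meet(2,1,3-)
proof (induction i arbitrary: j rule: nat_induct_non_zero)
  case 1
  have len: "0 < length q" "q ! 0 = r" "0 < length p" "p ! 0 = r" "distinct q"
    using p q by (auto simp: leg_from_def vpath_iff_nth)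
  have "(p ! 0, p ! 1) \<in> arcs_ends G"
    using p by (auto simp: leg_from_def vpath_iff_nth)
  then have "(q ! j, r) \<in> arcs_ends G"
    using 1 len arcs_ends_sym[OF G] by simp
  then have "r = q ! (j - 1) \<or> Suc j < length q \<and> r = q ! Suc j"
    using q 1 unfolding leg_from_def by blast
  then have "j = 1"
    using nth_eq_iff_index_eq[of q 0 "j - 1"] nth_eq_iff_index_eq[of q 0 "Suc j"] len 1 by auto
  then show ?case
    using 1 by simp
next
  case (Suc i)
  have len: "0 < length q" "q ! 0 = r" "0 < length p" "p ! 0 = r" "distinct p"
    using p q by (auto simp: leg_from_def vpath_iff_nth)
  have "(p ! i, p ! Suc i) \<in> arcs_ends G"
    using p Suc.prems by (auto simp: leg_from_def vpath_iff_nth)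
  then have "(q ! j, p ! i) \<in> arcs_ends G"
    using Suc.prems arcs_ends_sym[OF G] by metis
  then have "p ! i = q ! (j - 1) \<or> Suc j < length q \<and> p ! i = q ! Suc j"
    using q Suc.prems unfolding leg_from_def by blast
  then obtain j' where j': "p ! i = q ! j'" "j' < length q"
    using Suc.prems by (metis less_imp_diff_less)
  have "p ! i \<noteq> p ! 0"
    using nth_eq_iff_index_eq[of p i 0] len Suc by auto
  then have "0 < j'"
    using j' len by (metis gr0I)
  then show ?case
    using Suc.IH[of j'] j' Suc.prems by simp
qed

text \<open>
  The legs starting with the various neighbours of the root are disjoint outside the root, and a
  vertex on a leg has all its neighbours on the legs. By connectedness the legs therefore exhaust the
  tree. Listing them by increasing length gives the sorted spider.
\<close>
lemma starlike_tree_adj_iso_spider: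
  assumes "starlike_tree G"
  obtains ls \<phi> where "sorted ls" "0 \<notin> set ls" "3 \<le> length ls" "adj_iso \<phi> (spider ls) G"
proof -
  have tree: "undirected_tree G" and G: "graph G" and conn: "connected G"
    using assms by (auto simp: starlike_tree_def undirected_tree_def)
  obtain r where r: "r \<in> verts G" "2 < out_degree G r"
    and deg: "\<And>v. v \<in> verts G \<Longrightarrow> v \<noteq> r \<Longrightarrow> out_degree G v \<le> 2"
    using assms unfolding starlike_tree_def by (metis leI)
  let ?N = "{u. (r, u) \<in> arcs_ends G}"
  have card: "card ?N = out_degree G r"
    by (simp add: out_degree_eq_card_neighbours[OF G])
  then have "finite ?N"
    using r by (intro card_ge_0_finite) simp
  then obtain us where us: "set us = ?N" "distinct us"
    using finite_distinct_list by blast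
  have "\<exists>p. leg_from G r p \<and> p ! 1 = u" if "u \<in> ?N" for u
    using exists_leg_from[OF tree, of r u] deg that by blast
  then have "\<forall>u\<in>?N. \<exists>p. leg_from G r p \<and> p ! 1 = u"
    by blast
  from bchoice[OF this] obtain P where "\<forall>u\<in>?N. leg_from G r (P u) \<and> P u ! 1 = u" ..
  then have P: "\<And>u. u \<in> ?N \<Longrightarrow> leg_from G r (P u)" "\<And>u. u \<in> ?N \<Longrightarrow> P u ! 1 = u"
    by blast+
  define ps where "ps = sort_key length (map P us)"
  define ls where "ls = map (\<lambda>p. length p - 1) ps"
  have set_ps: "set ps = P ` ?N"
    using us by (simp add: ps_def)
  have "inj_on P ?N"
    using P(2) by (rule inj_on_inverseI)
  then have "distinct ps"
    using us by (simp add: ps_def distinct_map)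
  have length_ls: "length ls = out_degree G r"
    using us card by (simp add: ls_def ps_def distinct_card[symmetric])
  have "sorted (map length ps)"
    by (simp add: ps_def)
  then have "sorted ls"
    unfolding ls_def sorted_map by (rule sorted_wrt_mono_rel[rotated]) auto
  have leg: "leg_from G r (ps ! i)" if "i < length ls" for i
  proof -
    have "ps ! i \<in> set ps"
      using that by (simp add: ls_def)
    then show ?thesis
      using set_ps P(1) by auto
  qed
  have length_leg: "length (ps ! i) = Suc (ls ! i)" "0 < ls ! i" if "i < length ls" for i
    using leg[OF that] that by (auto simp: ls_def leg_from_def)
  have leg_0: "ps ! i ! 0 = r" if "i < length ls" for i
    using leg[OF that] length_leg[OF that] by (auto simp: leg_from_def)
  have leg_distinct: "distinct (ps ! i)" if "i < length ls" for i
    using leg[OF that] by (auto simp: leg_from_def vpath_iff_nth)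
  have disjoint: "i = i'" if "ps ! i ! j = ps ! i' ! j'" "i < length ls" "i' < length ls"
    "0 < j" "j \<le> ls ! i" "0 < j'" "j' \<le> ls ! i'" for i i' j j'
  proof -
    have "ps ! i ! 1 = ps ! i' ! 1"
      using that legs_meet_imp_same_start[OF G leg[of i] leg[of i']] by (simp add: length_leg)
    moreover have "ps ! i \<in> P ` ?N" "ps ! i' \<in> P ` ?N"
      using that set_ps[symmetric] by (simp_all add: ls_def)
    ultimately have "ps ! i = ps ! i'"
      using P(2) by force
    then show ?thesis
      using that \<open>distinct ps\<close> by (simp add: nth_eq_iff_index_eq ls_def)
  qed
  have k: "0 < length ls" "3 \<le> length ls"
    using r length_ls by auto
  define \<phi> where "\<phi> v = ps ! fst v ! snd v" for v
  have \<phi>: "\<phi> (spider_vert i j) = ps ! i ! j" if "i < length ls" for i j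
    using leg_0[OF that] leg_0[OF k(1)] by (simp add: \<phi>_def spider_vert_def)
  have nonroot: "ps ! i ! j \<noteq> r" if "i < length ls" "0 < j" "j \<le> ls ! i" for i j
  proof -
    have "ps ! i ! j \<noteq> ps ! i ! 0"
      using that leg_distinct[OF that(1)] by (simp add: nth_eq_iff_index_eq length_leg)
    then show ?thesis
      using leg_0 that by simp
  qed
  have inj: "inj_on \<phi> (verts (spider ls))"
  proof (rule inj_onI)
    fix v w assume "v \<in> verts (spider ls)" "w \<in> verts (spider ls)" and eq: "\<phi> v = \<phi> w"
    then obtain i j i' j' where vw: "v = spider_vert i j" "i < length ls" "j \<le> ls ! i"
      "w = spider_vert i' j'" "i' < length ls" "j' \<le> ls ! i'"
      by (auto simp: verts_spider)
    then have eq': "ps ! i ! j = ps ! i' ! j'"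
      using eq \<phi> by simp
    show "v = w"
    proof (cases "j = 0 \<or> j' = 0")
      case True
      then have "j = 0 \<and> j' = 0"
        using eq' vw nonroot[of i j] nonroot[of i' j'] leg_0 by (metis gr0I)
      then show ?thesis
        using vw by simp
    next
      case False
      then have "i = i'"
        using disjoint[OF eq'] vw by simp
      then show ?thesis
        using eq' vw leg_distinct[of i] by (simp add: nth_eq_iff_index_eq length_leg)
    qed
  qed
  have hom: "(\<phi> v, \<phi> w) \<in> arcs_ends G" if edge: "(v, w) \<in> arcs_ends (spider ls)" for v w
  proof -
    obtain i j where ij: "i < length ls" "j < ls ! i"
      and vw: "v = spider_vert i j \<and> w = spider_vert i (Suc j) \<or>
        v = spider_vert i (Suc j) \<and> w = spider_vert i j"
      using edge by (rule spider_edgeE)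
    have "(ps ! i ! j, ps ! i ! Suc j) \<in> arcs_ends G"
      using leg[OF ij(1)] ij length_leg by (simp add: leg_from_def vpath_iff_nth)
    then show ?thesis
      using vw \<phi> ij arcs_ends_sym[OF G] by auto
  qed
  \<comment> \<open>Neighbours lift along \<open>\<phi>\<close>; this gives both surjectivity and the reflection of edges.\<close>
  have closed: "\<exists>w \<in> verts (spider ls). \<phi> w = y \<and> (v, w) \<in> arcs_ends (spider ls)"
    if v: "v \<in> verts (spider ls)" and y: "(\<phi> v, y) \<in> arcs_ends G" for v y
  proof -
    obtain i j where ij: "v = spider_vert i j" "i < length ls" "j \<le> ls ! i"
      using v by (auto simp: verts_spider)
    have "\<exists>w. \<phi> w = y \<and> (v, w) \<in> arcs_ends (spider ls)"
    proof (cases "j = 0")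
      case True
      have "\<phi> v = r"
        unfolding ij(1) \<phi>[OF ij(2)] using True leg_0[OF ij(2)] by simp
      then have "y \<in> ?N"
        using y by simp
      then obtain i' where i': "i' < length ls" "ps ! i' = P y"
        using set_ps by (metis imageI in_set_conv_nth length_map ls_def)
      then have "\<phi> (spider_vert i' 1) = y"
        using \<phi> P(2) \<open>y \<in> ?N\<close> by simp
      moreover have "(v, spider_vert i' 1) \<in> arcs_ends (spider ls)"
        using spider_edgeI(1)[of i' ls 0] i' length_leg(2)[of i'] ij True by simp
      ultimately show ?thesis
        by blast
    next
      case False
      then have "y = ps ! i ! (j - 1) \<or> j < ls ! i \<and> y = ps ! i ! Suc j"
        using leg[OF ij(2)] y ij \<phi> length_leg unfolding leg_from_def by auto
      then show ?thesis
        using ij False \<phi>[OF ij(2)] spider_leg_adj_iff[of i ls j] by fastforce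
    qed
    then show ?thesis
      using arcs_ends_in_verts[OF graph_spider] by blast
  qed
  have "v \<in> \<phi> ` verts (spider ls)" if "v \<in> verts G" for v
  proof -
    interpret graph G by fact
    have "r \<rightarrow>\<^sup>*\<^bsub>G\<^esub> v"
      using symmetric_connected_imp_strongly_connected[OF sym_arcs conn] r that by auto
    then show ?thesis
    proof (induction rule: reachable_induct)
      case base
      have "\<phi> (spider_vert 0 0) = r" "spider_vert 0 0 \<in> verts (spider ls)"
        using \<phi>[OF k(1), of 0] leg_0[OF k(1)] k by (auto simp: verts_spider_eq)
      then show ?case
        by (metis imageI)
    next
      case (step x y)
      then show ?case
        using closed by blast
    qed
  qed
  moreover have "\<phi> v \<in> verts G" if v: "v \<in> verts (spider ls)" for v
  proof -
    obtain i j where ij: "v = spider_vert i j" "i < length ls" "j \<le> ls ! i"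
      using v by (auto simp: verts_spider)
    then show ?thesis
      using leg[of i] \<phi> length_leg by (simp add: leg_from_def vpath_iff_nth subset_iff)
  qed
  ultimately have "bij_betw \<phi> (verts (spider ls)) (verts G)"
    using inj by (auto simp: bij_betw_def)
  moreover have "(u, v) \<in> arcs_ends (spider ls) \<longleftrightarrow> (\<phi> u, \<phi> v) \<in> arcs_ends G"
    if uv: "u \<in> verts (spider ls)" "v \<in> verts (spider ls)" for u v
  proof
    assume "(\<phi> u, \<phi> v) \<in> arcs_ends G"
    then obtain w where "w \<in> verts (spider ls)" "\<phi> w = \<phi> v" "(u, w) \<in> arcs_ends (spider ls)"
      using closed[OF uv(1)] by blast
    then show "(u, v) \<in> arcs_ends (spider ls)"
      using inj_onD[OF inj, of w v] uv by simp
  qed (rule hom)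
  ultimately have "adj_iso \<phi> (spider ls) G"
    by (simp add: adj_iso_def)
  moreover have "0 \<notin> set ls"
    using length_leg by (metis in_set_conv_nth less_irrefl)
  ultimately show thesis
    using that \<open>sorted ls\<close> k by blast
qed

section \<open>Starlike trees are distinguished by their invariants\<close>
theorem theorem7:
  fixes f :: "nat list \<Rightarrow> real"
    and n :: nat
    and S :: "('a, 'b) pre_digraph"
    and S' :: "('c, 'd) pre_digraph"
  assumes symmetric_f: "\<And>xs. xs \<noteq> [] \<Longrightarrow> (\<forall>x\<in>set xs. x \<ge> 1) \<Longrightarrow> f xs = f (rev xs)"
    and a: "\<And>x y :: nat. x \<ge> 3 \<Longrightarrow> y \<ge> 3 \<Longrightarrow> x \<noteq> y \<Longrightarrow>
              (f [x] - f [y]) / (real x - real y) \<noteq> f [2] - f [1]"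
    and b: "\<And>x t :: nat. x \<ge> 1 \<Longrightarrow> x \<noteq> 2 \<Longrightarrow> g_diff f t x \<noteq> g_diff f t 2"
    and S: "S \<in> starlike_trees n"
    and S': "S' \<in> starlike_trees n"
  shows "digraph_iso S S' \<longleftrightarrow> (\<forall>h. order_invariant f h S = order_invariant f h S')"
proof -
  have G: "graph S" "graph S'"
    using S S' by (simp_all add: starlike_trees_def starlike_tree_def undirected_tree_def)
  obtain ls \<phi> where ls: "sorted ls" "0 \<notin> set ls" "3 \<le> length ls" and \<phi>: "adj_iso \<phi> (spider ls) S"
    using S starlike_tree_adj_iso_spider[of S] by (auto simp: starlike_trees_def)
  obtain ls' \<phi>' where ls': "sorted ls'" "0 \<notin> set ls'" "3 \<le> length ls'"
    and \<phi>': "adj_iso \<phi>' (spider ls') S'"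
    using S' starlike_tree_adj_iso_spider[of S'] by (auto simp: starlike_trees_def)
  have nonempty: "ls \<noteq> []" "ls' \<noteq> []"
    using ls ls' by auto
  have total: "sum_list ls = sum_list ls'"
  proof -
    have "card (verts (spider ls)) = card (verts S)" "card (verts (spider ls')) = card (verts S')"
      using \<phi> \<phi>' by (auto simp: adj_iso_def intro: bij_betw_same_card)
    then show ?thesis
      using S S' nonempty by (simp add: starlike_trees_def card_verts_spider)
  qed
  have sums: "(order_invariant f h S = order_invariant f h S') = (path_sum f h S = path_sum f h S')" for h
    using path_sum_eq_order_invariant_spider[where f = f and h = h, OF G(1) \<phi> ls(2) nonempty(1) symmetric_f]
      path_sum_eq_order_invariant_spider[where f = f and h = h, OF G(2) \<phi>' ls'(2) nonempty(2) symmetric_f]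
    by simp
  show ?thesis
    unfolding sums digraph_iso_iff_adj_iso[OF G]
  proof
    assume "\<exists>\<psi>. adj_iso \<psi> S S'"
    then show "\<forall>h. path_sum f h S = path_sum f h S'"
      using path_sum_adj_iso[OF G] by metis
  next
    assume eq: "\<forall>h. path_sum f h S = path_sum f h S'"
    have spiders: "path_sum f h (spider ls) = path_sum f h (spider ls')" for h
      using path_sum_adj_iso[OF graph_spider G(1) \<phi>, of f h]
        path_sum_adj_iso[OF graph_spider G(2) \<phi>', of f h] eq by simp
    have "ls = ls'"
      by (rule spider_leg_lengths_determined[where f = f])
        (fact ls ls' total symmetric_f a b spiders)+
    then show "\<exists>\<psi>. adj_iso \<psi> S S'"
      using adj_iso_comp[OF adj_iso_inv[OF \<phi>]] \<phi>' by blast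
  qed
qed

end
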